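(* Let $\mathscr{A}$ be a complex Banach algebra with unit $1$. Let $a,\delta a\in\mathscr{A}$ and let $p,q\in\mathscr{A}$ be idempotents such that $a^{(2,l)}_{p,q}$ exists. Suppose that $1+a^{(2,l)}_{p,q}\,\delta a$ is invertible. Put $\bar a=a+\delta a$ and $w=(1+a^{(2,l)}_{p,q}\,\delta a)^{-1}a^{(2,l)}_{p,q}$. Then the following statements are equivalent: (1) $w=\bar a^{(l)}_{p,q}$ (that is, $\bar a^{(l)}_{p,q}$ exists and equals $w$; equivalently $\bar a^{(2,l)}_{p,q}=\bar a^{(l)}_{p,q}$); (2) $R_r(\bar a)\cap R_r(q)=\{0\}$, i.e. $\bar a$ is a stable perturbation of $a$; (3) $\bar a(1+a^{(2,l)}_{p,q}\,\delta a)^{-1}(1-a^{(2,l)}_{p,q}a)=0$; (4) $(1-a\,a^{(2,l)}_{p,q})(1+\delta a\,a^{(2,l)}_{p,q})^{-1}\bar a=0$.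
   Context: For $x\in\mathscr{A}$ let $R_r(x)=\{xy: y\in\mathscr{A}\}$ and $K_r(x)=\{y\in\mathscr{A}: xy=0\}$. For $a\in\mathscr{A}$ and idempotents $p,q\in\mathscr{A}$, the $(p,q,l)$-outer generalized inverse $a^{(2,l)}_{p,q}$ is an element $b\in\mathscr{A}$ with $bab=b$, $R_r(b)=R_r(p)$, $K_r(b)=R_r(q)$; it is unique if it exists. If in addition $aba=a$, then $b$ is called the $(p,q,l)$-generalized inverse of $a$ and is denoted $a^{(l)}_{p,q}$. Here "stable perturbation" is by definition the condition $R_r(\bar a)\cap R_r(q)=\{0\}$ (note $R_r(q)=K_r(a^{(2,l)}_{p,q})$). (Recall $1+xy$ is invertible iff $1+yx$ is, so the inverse in (4) exists.) *)

theory Defs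
  imports "HOL-Analysis.Analysis"
begin

text \<open>
  The distribution has real Banach algebras only, so the complex structure is added as a class:
  a complex scalar multiplication that extends the real one, is compatible with the product and
  satisfies \<open>norm (scaleC c x) = cmod c * norm x\<close>. As \<open>monoid_mult\<close> is used instead
  of \<open>real_normed_algebra_1\<close>, neither \<open>norm 1 = 1\<close> nor \<open>1 \<noteq> 0\<close> is assumed.
\<close>

class complex_banach_algebra_unital = real_normed_algebra + monoid_mult + banach +
  fixes scaleC :: "complex \<Rightarrow> 'a \<Rightarrow> 'a"
  assumes scaleC_add_right: "scaleC c (x + y) = scaleC c x + scaleC c y"
    and scaleC_add_left: "scaleC (c + d) x = scaleC c x + scaleC d x"
    and scaleC_scaleC: "scaleC c (scaleC d x) = scaleC (c * d) x"
    and scaleC_one: "scaleC 1 x = x"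
    and scaleC_of_real: "scaleC (of_real r) x = scaleR r x"
    and mult_scaleC_left: "scaleC c x * y = scaleC c (x * y)"
    and mult_scaleC_right: "x * scaleC c y = scaleC c (x * y)"
    and norm_scaleC: "norm (scaleC c x) = cmod c * norm x"

instantiation complex :: complex_banach_algebra_unital
begin

definition scaleC_complex :: "complex \<Rightarrow> complex \<Rightarrow> complex"
  where "scaleC_complex c x = c * x"

instance
  by standard (simp_all add: scaleC_complex_def algebra_simps norm_mult scaleR_conv_of_real)

end

definition invertible_elem :: "'a::monoid_mult \<Rightarrow> bool"
  where "invertible_elem x \<longleftrightarrow> (\<exists>y. x * y = 1 \<and> y * x = 1)"

text \<open>Unspecified unless \<open>x\<close> is invertible.\<close>

definition inv_elem :: "'a::monoid_mult \<Rightarrow> 'a"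
  where "inv_elem x = (THE y. x * y = 1 \<and> y * x = 1)"

definition R_r :: "'a::times \<Rightarrow> 'a set"
  where "R_r x = {x * y | y. True}"

definition K_r :: "'a::mult_zero \<Rightarrow> 'a set"
  where "K_r x = {y. x * y = 0}"

definition is_outer_inv :: "'a::ring \<Rightarrow> 'a \<Rightarrow> 'a \<Rightarrow> 'a \<Rightarrow> bool"
  where "is_outer_inv a p q b \<longleftrightarrow> b * a * b = b \<and> R_r b = R_r p \<and> K_r b = R_r q"

definition is_gen_inv :: "'a::ring \<Rightarrow> 'a \<Rightarrow> 'a \<Rightarrow> 'a \<Rightarrow> bool"
  where "is_gen_inv a p q b \<longleftrightarrow> is_outer_inv a p q b \<and> a * b * a = a"

text \<open>
  \<open>outer_inv a p q\<close> is $a^{(2,l)}_{p,q}$ and \<open>gen_inv a p q\<close> is $a^{(l)}_{p,q}$. Both are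
  unspecified unless the corresponding existence predicate holds, so existence is always
  stated separately; uniqueness is shown below.
\<close>

definition outer_inv_exists :: "'a::ring \<Rightarrow> 'a \<Rightarrow> 'a \<Rightarrow> bool"
  where "outer_inv_exists a p q \<longleftrightarrow> (\<exists>b. is_outer_inv a p q b)"

definition outer_inv :: "'a::ring \<Rightarrow> 'a \<Rightarrow> 'a \<Rightarrow> 'a"
  where "outer_inv a p q = (THE b. is_outer_inv a p q b)"

definition gen_inv_exists :: "'a::ring \<Rightarrow> 'a \<Rightarrow> 'a \<Rightarrow> bool"
  where "gen_inv_exists a p q \<longleftrightarrow> (\<exists>b. is_gen_inv a p q b)"

definition gen_inv :: "'a::ring \<Rightarrow> 'a \<Rightarrow> 'a \<Rightarrow> 'a"
  where "gen_inv a p q = (THE b. is_gen_inv a p q b)"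

lemma inv_elem_eqI:
  fixes x y :: "'a::monoid_mult"
  assumes "x * y = 1" and "y * x = 1"
  shows "inv_elem x = y"
  unfolding inv_elem_def
proof (rule the_equality)
  show "x * y = 1 \<and> y * x = 1" using assms by simp
next
  fix z assume z: "x * z = 1 \<and> z * x = 1"
  have "z = z * (x * y)" using assms by simp
  also have "\<dots> = z * x * y" by (simp only: mult.assoc)
  finally show "z = y" using z by simp
qed

lemma is_outer_inv_unique:
  fixes a p q b c :: "'a::{ring, monoid_mult}"
  assumes b: "is_outer_inv a p q b" and c: "is_outer_inv a p q c"
  shows "b = c"
proof -
  have bab: "b * a * b = b" and cac: "c * a * c = c"
    and R: "R_r b = R_r c" and K: "K_r b = K_r c"
    using b c by (simp_all add: is_outer_inv_def)
  have "b \<in> R_r b" unfolding R_r_def using mult_1_right[of b] by (metis (mono_tags) mem_Collect_eq)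
  then obtain y where y: "b = c * y" using R by (auto simp: R_r_def)
  have cab: "c * a * b = b" using cac y by (metis mult.assoc)
  have "b * (1 - a * b) = 0" using bab by (simp add: right_diff_distrib mult.assoc)
  then have "c * (1 - a * b) = 0" using K by (auto simp: K_r_def)
  then have "c * a * b = c" by (simp add: right_diff_distrib mult.assoc)
  with cab show ?thesis by simp
qed

lemma outer_inv_eqI:
  fixes a p q b :: "'a::{ring, monoid_mult}"
  assumes "is_outer_inv a p q b"
  shows "outer_inv a p q = b"
  unfolding outer_inv_def using assms is_outer_inv_unique by blast

lemma gen_inv_eqI:
  fixes a p q b :: "'a::{ring, monoid_mult}"
  assumes "is_gen_inv a p q b"
  shows "gen_inv a p q = b"
  unfolding gen_inv_def using assms is_outer_inv_unique is_gen_inv_def by blast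

lemma invertible_elem_one_plus_swap:
  fixes x y :: "'a::{ring, monoid_mult}"
  assumes "invertible_elem (1 + x * y)"
  shows "invertible_elem (1 + y * x)"
proof -
  obtain z where z1: "(1 + x * y) * z = 1" and z2: "z * (1 + x * y) = 1"
    using assms by (auto simp: invertible_elem_def)
  have e1: "z + x * y * z = 1" and e2: "z + z * x * y = 1"
    using z1 z2 by (simp_all add: algebra_simps)
  have "(1 + y * x) * (1 - y * z * x) = 1 + y * x - y * (z + x * y * z) * x"
    by (simp add: algebra_simps)
  moreover have "(1 - y * z * x) * (1 + y * x) = 1 + y * x - y * (z + z * x * y) * x"
    by (simp add: algebra_simps)
  ultimately have "(1 + y * x) * (1 - y * z * x) = 1" "(1 - y * z * x) * (1 + y * x) = 1"
    by (simp_all add: e1 e2)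
  then show ?thesis unfolding invertible_elem_def by blast
qed

end

theory Submission
  imports Defs
begin

text \<open>
  The element \<open>w\<close> is always the \<open>(p,q,l)\<close>-outer generalized inverse of \<open>abar\<close>, because multiplying
  \<open>b\<close> by a unit on either side changes neither \<open>R_r b\<close> nor \<open>K_r b\<close>. Hence each of the four
  conditions amounts to \<open>abar * w * abar = abar\<close>; for (3) and (4) this comes from
  \<open>(1 + b * \<delta>a)\<inverse> * (1 - b * a) = 1 - w * abar\<close> and \<open>(1 - a * b) * (1 + \<delta>a * b)\<inverse> = 1 - abar * w\<close>.
\<close>

lemma inv_elem:
  fixes x :: "'a::monoid_mult"
  assumes "invertible_elem x"
  shows "x * inv_elem x = 1" and "inv_elem x * x = 1"
  using assms inv_elem_eqI unfolding invertible_elem_def by blast+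

lemma R_r_mult_unit:
  fixes b e f :: "'a::monoid_mult"
  assumes "e * f = 1"
  shows "R_r (b * e) = R_r b"
proof -
  have "b * y = b * e * (f * y)" for y
    using assms by (metis mult.assoc mult_1_left)
  then show ?thesis
    unfolding R_r_def using mult.assoc[of b e] by blast
qed

text \<open>A left inverse \<open>d\<close> of \<open>c\<close> cancels the extra factor:
  \<open>b * y = d * (c * b * y)\<close>.\<close>

lemma K_r_unit_mult:
  fixes b c d :: "'a::{ring, monoid_mult}"
  assumes "d * c = 1"
  shows "K_r (c * b) = K_r b"
proof -
  have "b * y = d * (c * b * y)" for y
    using assms by (metis mult.assoc mult_1_left)
  then have "b * y = 0" if "c * b * y = 0" for y
    using that by (metis mult_zero_right)
  then show ?thesis
    unfolding K_r_def by (auto simp: mult.assoc)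
qed

text \<open>Comes from \<open>b * (1 + d * b) = (1 + b * d) * b\<close> by cancelling a unit on each
  side. It moves the unit factor of \<open>w\<close> from the left of \<open>b\<close> to the
  right.\<close>

lemma inv_elem_one_plus_swap:
  fixes b d :: "'a::{ring, monoid_mult}"
  assumes "invertible_elem (1 + b * d)"
  shows "inv_elem (1 + b * d) * b = b * inv_elem (1 + d * b)"
proof -
  note c = inv_elem[OF assms]
  note e = inv_elem[OF invertible_elem_one_plus_swap[OF assms]]
  have "inv_elem (1 + b * d) * b = inv_elem (1 + b * d) * (b * (1 + d * b)) * inv_elem (1 + d * b)"
    by (simp add: mult.assoc e)
  also have "b * (1 + d * b) = (1 + b * d) * b"
    by (simp add: algebra_simps)
  finally show ?thesis
    by (simp add: mult.assoc[symmetric] c)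
qed

text \<open>Both factorizations of the new element are used: unit times \<open>b\<close> preserves
  the kernel, \<open>b\<close> times unit preserves the range.\<close>

lemma is_outer_inv_perturb:
  fixes a d p q b :: "'a::{ring, monoid_mult}"
  assumes b: "is_outer_inv a p q b" and inv: "invertible_elem (1 + b * d)"
  shows "is_outer_inv (a + d) p q (inv_elem (1 + b * d) * b)"
proof -
  define c e w where "c = inv_elem (1 + b * d)" and "e = inv_elem (1 + d * b)" and "w = c * b"
  have c: "(1 + b * d) * c = 1" and e: "(1 + d * b) * e = 1" "e * (1 + d * b) = 1"
    unfolding c_def e_def
    using inv_elem[OF inv] inv_elem[OF invertible_elem_one_plus_swap[OF inv]] by auto
  have w: "w = b * e"
    unfolding w_def c_def e_def by (rule inv_elem_one_plus_swap[OF inv])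
  \<comment> \<open>Left multiplication by \<open>b * a\<close> fixes every right multiple of
    \<open>b\<close>, and \<open>w = b * e\<close> is one.\<close>
  have "b * a * w = w"
    using b unfolding w is_outer_inv_def by (metis mult.assoc)
  then have "b * (a + d) * w = (1 + b * d) * w"
    by (simp add: algebra_simps)
  also have "\<dots> = b"
    unfolding w_def by (simp add: c mult.assoc[symmetric])
  \<comment> \<open>Multiply \<open>b * (a + d) * w = b\<close> by \<open>c\<close> on the
    left.\<close>
  finally have "w * (a + d) * w = w"
    by (metis w_def mult.assoc)
  moreover have "R_r w = R_r b"
    unfolding w by (rule R_r_mult_unit[OF e(2)])
  moreover have "K_r w = K_r b"
    unfolding w_def by (rule K_r_unit_mult[OF c])
  ultimately show ?thesis
    using b unfolding is_outer_inv_def w_def c_def by simp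
qed

text \<open>Outer inverses with given \<open>p\<close> and \<open>q\<close> are unique, so
  \<open>w\<close> is the only candidate for a generalized inverse.\<close>

lemma gen_inv_iff_outer_inv:
  fixes x p q w :: "'a::{ring, monoid_mult}"
  assumes w: "is_outer_inv x p q w"
  shows "gen_inv_exists x p q \<longleftrightarrow> x * w * x = x"
    and "gen_inv_exists x p q \<Longrightarrow> gen_inv x p q = w"
proof -
  have "v = w" if "is_gen_inv x p q v" for v
    using that w is_outer_inv_unique unfolding is_gen_inv_def by blast
  then have *: "gen_inv_exists x p q \<longleftrightarrow> is_gen_inv x p q w"
    unfolding gen_inv_exists_def by blast
  then show "gen_inv_exists x p q \<longleftrightarrow> x * w * x = x"
    using w unfolding is_gen_inv_def by simp
  show "gen_inv x p q = w" if "gen_inv_exists x p q"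
    using that * gen_inv_eqI by blast
qed

lemma R_r_Int_R_r_eq_0_iff:
  fixes x p q w :: "'a::{ring, monoid_mult}"
  assumes w: "is_outer_inv x p q w"
  shows "R_r x \<inter> R_r q = {0} \<longleftrightarrow> x * w * x = x"
proof -
  have wxw: "w * x * w = w" and K: "R_r q = K_r w"
    using w unfolding is_outer_inv_def by auto
  show ?thesis
  proof
    assume *: "R_r x \<inter> R_r q = {0}"
    \<comment> \<open>The witness is the defect \<open>x - x * w * x\<close>: it is a right multiple
      of \<open>x\<close>, and \<open>w * x * w = w\<close> puts it in the kernel of
      \<open>w\<close>.\<close>
    have "w * (x * (1 - w * x)) = w * x - w * x * w * x"
      by (simp add: algebra_simps)
    then have "x * (1 - w * x) \<in> R_r x \<inter> R_r q"
      unfolding K by (auto simp: R_r_def K_r_def wxw)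
    then show "x * w * x = x"
      using * by (simp add: algebra_simps)
  next
    assume x: "x * w * x = x"
    \<comment> \<open>Here \<open>x * y = x * (w * (x * y))\<close>.\<close>
    have "x * y = 0" if "w * (x * y) = 0" for y
      using that x by (metis mult.assoc mult_zero_right)
    moreover have "0 \<in> R_r x"
      unfolding R_r_def by (metis (mono_tags) mem_Collect_eq mult_zero_right)
    ultimately show "R_r x \<inter> R_r q = {0}"
      unfolding K by (auto simp: R_r_def K_r_def)
  qed
qed

text \<open>Splitting \<open>1 - b * a\<close> as \<open>(1 + b * d) - b * (a + d)\<close> lets the
  inverse cancel the first term.\<close>

lemma inv_elem_mult_one_minus:
  fixes a b d :: "'a::{ring, monoid_mult}"
  assumes "invertible_elem (1 + b * d)"
  shows "inv_elem (1 + b * d) * (1 - b * a) = 1 - inv_elem (1 + b * d) * b * (a + d)"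
proof -
  have "1 - b * a = (1 + b * d) - b * (a + d)"
    by (simp add: algebra_simps)
  then show ?thesis
    by (simp only: right_diff_distrib inv_elem[OF assms] mult.assoc)
qed

lemma one_minus_mult_inv_elem:
  fixes a b d :: "'a::{ring, monoid_mult}"
  assumes "invertible_elem (1 + d * b)"
  shows "(1 - a * b) * inv_elem (1 + d * b) = 1 - (a + d) * (b * inv_elem (1 + d * b))"
proof -
  have "1 - a * b = (1 + d * b) - (a + d) * b"
    by (simp add: algebra_simps)
  then show ?thesis
    by (simp only: left_diff_distrib inv_elem[OF assms] mult.assoc)
qed

theorem theorem3p6:
  fixes a \<delta>a p q b abar w :: "'a::complex_banach_algebra_unital"
  assumes "p * p = p" and "q * q = q"
    and "outer_inv_exists a p q"
    and "b = outer_inv a p q"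
    and "invertible_elem (1 + b * \<delta>a)"
    and "abar = a + \<delta>a"
    and "w = inv_elem (1 + b * \<delta>a) * b"
  shows
    "((gen_inv_exists abar p q \<and> gen_inv abar p q = w) \<longleftrightarrow>
      (outer_inv_exists abar p q \<and> gen_inv_exists abar p q \<and>
        outer_inv abar p q = gen_inv abar p q)) \<and>
     ((gen_inv_exists abar p q \<and> gen_inv abar p q = w) \<longleftrightarrow>
      R_r abar \<inter> R_r q = {0}) \<and>
     (R_r abar \<inter> R_r q = {0} \<longleftrightarrow>
      abar * inv_elem (1 + b * \<delta>a) * (1 - b * a) = 0) \<and>
     (abar * inv_elem (1 + b * \<delta>a) * (1 - b * a) = 0 \<longleftrightarrow>
      (1 - a * b) * inv_elem (1 + \<delta>a * b) * abar = 0)"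
proof -
  have b: "is_outer_inv a p q b"
    using assms(3,4) outer_inv_eqI unfolding outer_inv_exists_def by blast
  have w: "is_outer_inv abar p q w"
    using is_outer_inv_perturb[OF b assms(5)] assms(6,7) by simp
  \<comment> \<open>Condition (4) contains the inverse of \<open>1 + \<delta>a * b\<close>, so it
    needs this form of \<open>w\<close>.\<close>
  have w': "w = b * inv_elem (1 + \<delta>a * b)"
    using assms(7) inv_elem_one_plus_swap[OF assms(5)] by simp
  have "(gen_inv_exists abar p q \<and> gen_inv abar p q = w) \<longleftrightarrow> abar * w * abar = abar"
    using gen_inv_iff_outer_inv[OF w] by blast
  \<comment> \<open>Since \<open>outer_inv abar p q\<close> is \<open>w\<close> in any case, only
    the existence of the generalized inverse is at stake.\<close>
  moreover have "outer_inv_exists abar p q \<and> gen_inv_exists abar p q \<and>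
      outer_inv abar p q = gen_inv abar p q \<longleftrightarrow> abar * w * abar = abar"
    using gen_inv_iff_outer_inv[OF w] outer_inv_eqI[OF w] w
    unfolding outer_inv_exists_def by metis
  moreover have "R_r abar \<inter> R_r q = {0} \<longleftrightarrow> abar * w * abar = abar"
    by (rule R_r_Int_R_r_eq_0_iff[OF w])
  moreover have "abar * inv_elem (1 + b * \<delta>a) * (1 - b * a) = 0 \<longleftrightarrow> abar * w * abar = abar"
  proof -
    have "inv_elem (1 + b * \<delta>a) * (1 - b * a) = 1 - w * abar"
      unfolding assms(6,7) by (rule inv_elem_mult_one_minus[OF assms(5)])
    then have "abar * inv_elem (1 + b * \<delta>a) * (1 - b * a) = abar * (1 - w * abar)"
      by (simp only: mult.assoc)
    also have "\<dots> = abar - abar * w * abar"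
      by (simp add: right_diff_distrib mult.assoc)
    finally show ?thesis
      by (metis eq_iff_diff_eq_0)
  qed
  moreover have "(1 - a * b) * inv_elem (1 + \<delta>a * b) * abar = 0 \<longleftrightarrow> abar * w * abar = abar"
  proof -
    have "(1 - a * b) * inv_elem (1 + \<delta>a * b) = 1 - abar * w"
      unfolding assms(6) w'
      by (rule one_minus_mult_inv_elem[OF invertible_elem_one_plus_swap[OF assms(5)]])
    then have "(1 - a * b) * inv_elem (1 + \<delta>a * b) * abar = abar - abar * w * abar"
      by (simp only: left_diff_distrib mult_1_left)
    then show ?thesis
      by (metis eq_iff_diff_eq_0)
  qed
  ultimately show ?thesis
    by argo
qed

end
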